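(* For every input sequence $I$ with agreeable deadlines, the randomized online algorithm $\mathrm{RG}$ (defined in the context) satisfies $\mathbf{E}[\mathcal{G}_{\mathrm{RG}}(I)]\ge \frac{3}{4}\,\mathcal{G}_{\mathrm{OPT}}(I)$, where $\mathcal{G}_{\mathrm{OPT}}(I)$ is the maximum total weight of a feasible schedule of $I$ and the expectation is over the random choices of $\mathrm{RG}$; that is, $\mathrm{RG}$ is $\frac43$-competitive against an oblivious adversary on sequences with agreeable deadlines.
   Context: Online packet scheduling (buffer management with bounded delay): time is divided into integer steps $1,2,\dots$. An input sequence is a finite set of packets; packet $j$ has a release time $r_j$ (a step), a deadline $d_j>r_j$ and a positive weight $w_j$. Packets released in the same step are assumed to arrive one after another (distinct fractional release times within the step). Packet $j$ is pending at step $t$ if $r_j\le t<d_j$ and $j$ has not yet been transmitted. In each step at most one pending packet may be transmitted; the gain is the total weight of transmitted packets. An online algorithm decides at step $t$ knowing only packets with $r_j\le t$; the input sequence is fixed in advance independently of the algorithm's random bits (oblivious adversary). A sequence has agreeable deadlines if $r_i<r_j$ implies $d_i\le d_j$. A schedule is a map from steps to packets; it is feasible if it is injective and each packet assigned to step $t$ is pending at $t$. Define the linear order $\unlhd$ on packets: $i\unlhd j$ iff $d_i<d_j$, or $d_i=d_j$ and $w_i>w_j$, or $d_i=d_j$, $w_i=w_j$ and $r_i\le r_j$. A feasible schedule $S$ is a $\unlhd$-schedule if for every step $t$ the packet $S(t)$ is the $\unlhd$-minimum among the packets of $S$ pending at $t$. At step $t$, let $O_t$ be any (arbitrarily chosen)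 feasible $\unlhd$-schedule of maximum total weight over the packets currently pending in the algorithm's buffer at step $t$, using steps $\ge t$ and ignoring future arrivals. Let $e=O_t(t)$ be the $\unlhd$-minimal packet of $O_t$ and $h$ the $\unlhd$-minimal among the maximum-weight packets of $O_t$. Algorithm $\mathrm{RG}$ at each step $t$: computes $O_t,e,h$, and transmits $e$ with probability $w_e/w_h$ and $h$ with probability $1-w_e/w_h$. *)

theory Defs
  imports "HOL-Probability.Probability"
begin

text \<open>
  Time is divided into steps \<open>1, 2, \<dots>\<close>.  The component \<open>arrival\<close> is the fractional release time
  of a packet: its integral part is the release step, and its fractional part only records the order
  in which the packets of one step arrive, which serves to break ties.
\<close>

datatype packet = Packet (arrival: real) (deadline: nat) (weight: real)

definition release :: "packet \<Rightarrow> nat" where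
  "release j = nat \<lfloor>arrival j\<rfloor>"

definition input_sequence :: "packet set \<Rightarrow> bool" where
  "input_sequence I \<longleftrightarrow>
     finite I \<and> inj_on arrival I \<and>
     (\<forall>j\<in>I. 1 \<le> arrival j \<and> release j < deadline j \<and> 0 < weight j)"

definition agreeable_deadlines :: "packet set \<Rightarrow> bool" where
  "agreeable_deadlines I \<longleftrightarrow> (\<forall>i\<in>I. \<forall>j\<in>I. release i < release j \<longrightarrow> deadline i \<le> deadline j)"

definition packet_le :: "packet \<Rightarrow> packet \<Rightarrow> bool" (infix "\<unlhd>" 50) where
  "i \<unlhd> j \<longleftrightarrow>
     deadline i < deadline j \<or>
     deadline i = deadline j \<and> weight i > weight j \<or>
     deadline i = deadline j \<and> weight i = weight j \<and> arrival i \<le> arrival j"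

definition packet_min :: "packet set \<Rightarrow> packet" where
  "packet_min P = (THE j. j \<in> P \<and> (\<forall>i\<in>P. j \<unlhd> i))"

lemma packet_le_linear_order:
  "i \<unlhd> i"
  "i \<unlhd> j \<Longrightarrow> j \<unlhd> i \<Longrightarrow> i = j"
  "i \<unlhd> j \<Longrightarrow> j \<unlhd> k \<Longrightarrow> i \<unlhd> k"
  "i \<unlhd> j \<or> j \<unlhd> i"
  by (auto simp: packet_le_def intro: packet.expand)

text \<open>The packets of \<open>P\<close> pending at step \<open>t\<close> when those of \<open>X\<close> have already been transmitted.\<close>

definition pending :: "packet set \<Rightarrow> packet set \<Rightarrow> nat \<Rightarrow> packet set" where
  "pending P X t = {j \<in> P. release j \<le> t \<and> t < deadline j \<and> j \<notin> X}"

text \<open>A schedule assigns at most one packet to each step; \<open>None\<close> marks an idle step.\<close>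

type_synonym schedule = "nat \<Rightarrow> packet option"

definition sent_before :: "schedule \<Rightarrow> nat \<Rightarrow> packet set" where
  "sent_before S t = {j. \<exists>s<t. S s = Some j}"

definition feasible :: "packet set \<Rightarrow> schedule \<Rightarrow> bool" where
  "feasible P S \<longleftrightarrow>
     inj_on S (dom S) \<and> (\<forall>t j. S t = Some j \<longrightarrow> j \<in> pending P (sent_before S t) t)"

definition schedule_weight :: "schedule \<Rightarrow> real" where
  "schedule_weight S = (\<Sum>j\<in>ran S. weight j)"

definition opt_gain :: "packet set \<Rightarrow> real" where
  "opt_gain I = Max (schedule_weight ` {S. feasible I S})"

text \<open>
  A \<open>\<unlhd>\<close>-schedule that uses only the steps from \<open>t\<close> on: a step \<open>s \<ge> t\<close> is idle only if no packet of
  the schedule is pending at \<open>s\<close>, and otherwise gets the \<open>\<unlhd>\<close>-minimum of those.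
\<close>

definition le_schedule_from :: "nat \<Rightarrow> schedule \<Rightarrow> bool" where
  "le_schedule_from t S \<longleftrightarrow>
     dom S \<subseteq> {t..} \<and>
     (\<forall>s\<ge>t. let Q = pending (ran S) (sent_before S s) s
            in S s = (if Q = {} then None else Some (packet_min Q)))"

definition optimal_le_schedule :: "nat \<Rightarrow> packet set \<Rightarrow> schedule \<Rightarrow> bool" where
  "optimal_le_schedule t B S \<longleftrightarrow>
     feasible B S \<and> le_schedule_from t S \<and>
     (\<forall>S'. feasible B S' \<and> le_schedule_from t S' \<longrightarrow> schedule_weight S' \<le> schedule_weight S)"

text \<open>
  A history lists what was transmitted in the steps \<open>1, 2, \<dots>\<close> so far, with \<open>None\<close> for an idle step.
  So the step following the history \<open>xs\<close> is \<open>Suc (length xs)\<close>.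
\<close>

type_synonym history = "packet option list"

definition transmitted :: "history \<Rightarrow> packet set" where
  "transmitted xs = {j. Some j \<in> set xs}"

definition gain :: "history \<Rightarrow> real" where
  "gain xs = (\<Sum>x\<leftarrow>xs. case x of None \<Rightarrow> 0 | Some j \<Rightarrow> weight j)"

definition arrived :: "packet set \<Rightarrow> nat \<Rightarrow> packet set" where
  "arrived I t = {j \<in> I. release j \<le> t}"

text \<open>
  The schedule \<open>O\<^sub>t\<close> may be any optimal one.  A choice rule fixes it, as a function of what an
  online algorithm knows: the set \<open>A\<close> of packets that have arrived so far, and the history.
\<close>

type_synonym choice_rule = "packet set \<Rightarrow> history \<Rightarrow> schedule"

definition valid_choice_rule :: "choice_rule \<Rightarrow> bool" where
  "valid_choice_rule C \<longleftrightarrow>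
     (\<forall>A xs. let t = Suc (length xs) in
        input_sequence A \<and> (\<forall>j\<in>A. release j \<le> t) \<longrightarrow>
        optimal_le_schedule t (pending A (transmitted xs) t) (C A xs))"

text \<open>Optimal schedules, and hence valid choice rules, exist.\<close>

lemma ex_optimal_le_schedule:
  assumes "finite B"
  shows "\<exists>S. optimal_le_schedule t B S"
proof -
  let ?F = "{S. feasible B S \<and> le_schedule_from t S}"
  have "schedule_weight ` ?F \<subseteq> sum weight ` Pow B"
  proof
    fix x assume "x \<in> schedule_weight ` ?F"
    then obtain S where S: "feasible B S" "x = schedule_weight S" by auto
    then have "ran S \<subseteq> B" by (auto simp: feasible_def pending_def ran_def)
    then show "x \<in> sum weight ` Pow B" using S by (auto simp: schedule_weight_def)
  qed
  then have fin: "finite (schedule_weight ` ?F)"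
    using assms by (meson finite_Pow_iff finite_imageI finite_subset)
  have "Map.empty \<in> ?F"
    by (simp add: feasible_def le_schedule_from_def pending_def Let_def)
  then have "Max (schedule_weight ` ?F) \<in> schedule_weight ` ?F"
    using fin by (intro Max_in) blast+
  then obtain S where S: "S \<in> ?F" "schedule_weight S = Max (schedule_weight ` ?F)"
    by fastforce
  have "schedule_weight S' \<le> schedule_weight S" if "S' \<in> ?F" for S'
    unfolding S(2) using fin that by (intro Max_ge imageI)
  then show ?thesis
    using S(1) unfolding optimal_le_schedule_def by blast
qed

lemma ex_valid_choice_rule: "\<exists>C. valid_choice_rule C"
proof
  let ?C = "\<lambda>A xs. SOME S. optimal_le_schedule (Suc (length xs))
                            (pending A (transmitted xs) (Suc (length xs))) S"
  have "finite (pending A X t)" if "input_sequence A" for A X t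
    using that by (simp add: pending_def input_sequence_def)
  then show "valid_choice_rule ?C"
    unfolding valid_choice_rule_def Let_def by (auto intro!: someI_ex[OF ex_optimal_le_schedule])
qed

definition heaviest :: "schedule \<Rightarrow> packet" where
  "heaviest S = packet_min {j \<in> ran S. \<forall>i\<in>ran S. weight i \<le> weight j}"

text \<open>
  The packet that RG transmits in step \<open>t = Suc (length xs)\<close>.  The schedule \<open>O\<^sub>t\<close> is idle at \<open>t\<close>
  only if no packet is pending.
\<close>

definition rg_step :: "choice_rule \<Rightarrow> packet set \<Rightarrow> history \<Rightarrow> packet option pmf" where
  "rg_step C I xs =
     (let t = Suc (length xs); S = C (arrived I t) xs in
      case S t of
        None \<Rightarrow> return_pmf None
      | Some e \<Rightarrow>
          (let h = heaviest S in
           map_pmf (\<lambda>b. Some (if b then e else h)) (bernoulli_pmf (weight e / weight h))))"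

primrec rg_run :: "choice_rule \<Rightarrow> packet set \<Rightarrow> nat \<Rightarrow> history pmf" where
  "rg_run C I 0 = return_pmf []"
| "rg_run C I (Suc n) =
     bind_pmf (rg_run C I n) (\<lambda>xs. map_pmf (\<lambda>x. xs @ [x]) (rg_step C I xs))"

text \<open>No packet is pending after the last deadline, so the run may be stopped there.\<close>

definition horizon :: "packet set \<Rightarrow> nat" where
  "horizon I = Max (insert 0 (deadline ` I))"

definition rg_expected_gain :: "choice_rule \<Rightarrow> packet set \<Rightarrow> real" where
  "rg_expected_gain C I = measure_pmf.expectation (rg_run C I (horizon I)) gain"

end

theory Submission
  imports Defs
begin

text \<open>
  Let \<open>V t Y\<close> be the maximum weight of a subset of \<open>Y\<close> that can be scheduled in the steps from \<open>t\<close>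
  on.  The sum of \<open>4 / 3\<close> times the gain so far and \<open>V\<close> of the packets not yet transmitted does not
  decrease in expectation.  Indeed, fix an optimum \<open>A\<close> for \<open>V t Y\<close> whose pending packets all belong
  to \<open>O\<^sub>t\<close>; such an \<open>A\<close> exists by the exchange property of matchings.  If \<open>e \<in> A\<close>, then step \<open>t\<close>
  may be given to \<open>e\<close>, so transmitting \<open>e\<close> costs \<open>w\<^sub>e\<close> and transmitting \<open>h\<close> costs at most
  \<open>w\<^sub>e + w\<^sub>h\<close>, which is \<open>w\<^sub>h\<close> on average.  If \<open>e \<notin> A\<close>, each of the two costs at most \<open>w\<^sub>h\<close>: the
  pending part of \<open>A\<close> fits into \<open>O\<^sub>t\<close> without \<open>e\<close> and hence can be delayed by one step, so that, by
  agreeable deadlines, removing \<open>h\<close> from \<open>A\<close> leaves a set that does not need step \<open>t\<close>.  Finally,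
  with \<open>p = w\<^sub>e / w\<^sub>h\<close>, the expected gain of the step is \<open>(p\<^sup>2 - p + 1) w\<^sub>h \<ge> 3 / 4 * w\<^sub>h\<close>.
\<close>

section \<open>Matchings in bipartite graphs and their exchange property\<close>

text \<open>The independent sets of the transversal matroid of the graph \<open>E\<close>. As
  \<open>E\<close> is a parameter, a vertex of type \<open>'b\<close> can be deleted by
  strengthening the relation.\<close>

definition matchable :: "('a \<Rightarrow> 'b \<Rightarrow> bool) \<Rightarrow> 'a set \<Rightarrow> bool" where
  "matchable E X \<longleftrightarrow> (\<exists>f. inj_on f X \<and> (\<forall>x\<in>X. E x (f x)))"

lemma matchable_subset: "matchable E X \<Longrightarrow> Y \<subseteq> X \<Longrightarrow> matchable E Y"
  unfolding matchable_def by (meson inj_on_subset subsetD)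

lemma matchable_insert:
  assumes "matchable (\<lambda>x u. E x u \<and> u \<noteq> s) X" "E k s"
  shows "matchable E (insert k X)"
proof -
  obtain f where f: "inj_on f X" "\<forall>x\<in>X. E x (f x) \<and> f x \<noteq> s"
    using assms(1) unfolding matchable_def by blast
  have "inj_on (f(k := s)) (insert k X)"
    using f by (auto simp: inj_on_def)
  moreover have "\<forall>x\<in>insert k X. E x ((f(k := s)) x)"
    using f assms(2) by auto
  ultimately show ?thesis
    unfolding matchable_def by blast
qed

text \<open>
  This is the symmetric exchange along the alternating path that starts at \<open>k\<close>; the induction
  follows the path, deleting one element of type \<open>'b\<close> in each step.
\<close>

lemma matchable_exchange:
  assumes "finite A" "matchable E A" "matchable E R" "k \<in> A" "k \<notin> R"
  shows "matchable E (insert k R) \<or>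
    (\<exists>m\<in>R - A. matchable E (insert m (A - {k})) \<and> matchable E (insert k (R - {m})))"
  using assms
proof (induction A arbitrary: k R E rule: finite_psubset_induct)
  case (psubset A)
  obtain f where f: "inj_on f A" "\<forall>x\<in>A. E x (f x)"
    using psubset.prems(1) unfolding matchable_def by blast
  obtain g where g: "inj_on g R" "\<forall>x\<in>R. E x (g x)"
    using psubset.prems(2) unfolding matchable_def by blast
  define s where "s = f k"
  define E' where "E' = (\<lambda>x u. E x u \<and> u \<noteq> s)"
  have Eks: "E k s"
    using f psubset.prems by (simp add: s_def)
  have ins: "matchable E (insert x X)" if "matchable E' X" "E x s" for x X
    using matchable_insert that unfolding E'_def by metis
  have A1: "matchable E' (A - {k})"
    unfolding matchable_def E'_def s_def using f psubset.prems
    by (intro exI[of _ f]) (auto simp: inj_on_def)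
  show ?case
  proof (cases "\<exists>m\<in>R. g m = s")
    case False
    then have "matchable E' R"
      unfolding matchable_def E'_def using g by auto
    then show ?thesis
      using ins Eks by blast
  next
    case True
    then obtain m where m: "m \<in> R" "g m = s" by blast
    have Ems: "E m s" using g m by auto
    have R1: "matchable E' (R - {m})"
      unfolding matchable_def E'_def using g m
      by (intro exI[of _ g]) (auto simp: inj_on_def)
    \<comment> \<open>If \<open>m\<close> is outside \<open>A\<close>, the path ends here and
      \<open>s\<close> passes between \<open>m\<close> and \<open>k\<close>. Otherwise it goes on
      from \<open>m\<close>, which is now the element to be placed into
      \<open>R - {m}\<close>.\<close>
    show ?thesis
    proof (cases "m \<in> A")
      case False
      then show ?thesis
        using ins[OF A1 Ems] ins[OF R1 Eks] m by blast
    next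
      case True
      have mk: "m \<noteq> k" using m psubset.prems by auto
      have "A - {k} \<subset> A" using psubset.prems by auto
      from psubset.IH[OF this A1 R1] True mk
      consider "matchable E' (insert m (R - {m}))"
        | m' where "m' \<in> R - {m} - (A - {k})"
            "matchable E' (insert m' (A - {k} - {m}))"
            "matchable E' (insert m (R - {m} - {m'}))"
        by blast
      then show ?thesis
      proof cases
        case 1
        then show ?thesis using ins[OF _ Eks] m by (simp add: insert_absorb)
      next
        case 2
        have "m' \<in> R - A" using 2 psubset.prems by auto
        moreover have "insert m (insert m' (A - {k} - {m})) = insert m' (A - {k})"
          using True mk by auto
        then have "matchable E (insert m' (A - {k}))"
          using ins[OF 2(2) Ems] by simp
        moreover have "insert m (R - {m} - {m'}) = R - {m'}"
          using m 2 by auto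
        then have "matchable E (insert k (R - {m'}))"
          using ins[OF 2(3) Eks] by simp
        ultimately show ?thesis by blast
      qed
    qed
  qed
qed

section \<open>Schedulable sets of packets and \<unlhd>-schedules\<close>

definition schedulable :: "nat \<Rightarrow> packet set \<Rightarrow> bool" where
  "schedulable t = matchable (\<lambda>x s. t \<le> s \<and> release x \<le> s \<and> s < deadline x)"

lemma schedulableI:
  assumes "inj_on f X" "\<And>x. x \<in> X \<Longrightarrow> t \<le> f x \<and> release x \<le> f x \<and> f x < deadline x"
  shows "schedulable t X"
  using assms unfolding schedulable_def matchable_def by blast

lemma schedulable_subset: "schedulable t X \<Longrightarrow> Y \<subseteq> X \<Longrightarrow> schedulable t Y"
  unfolding schedulable_def by (rule matchable_subset)

lemma packet_min_eqI:
  assumes "x \<in> P" "\<And>y. y \<in> P \<Longrightarrow> x \<unlhd> y"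
  shows "packet_min P = x"
  unfolding packet_min_def using assms packet_le_linear_order(2) by (intro the_equality) auto

lemma packet_min:
  assumes "finite P" "P \<noteq> {}"
  shows "packet_min P \<in> P" "\<And>y. y \<in> P \<Longrightarrow> packet_min P \<unlhd> y"
proof -
  have "\<exists>x\<in>P. \<forall>y\<in>P. x \<unlhd> y"
    using assms
  proof (induction rule: finite_ne_induct)
    case (singleton x)
    then show ?case by (simp add: packet_le_linear_order(1))
  next
    case (insert x F)
    then obtain z where z: "z \<in> F" "\<forall>y\<in>F. z \<unlhd> y" by blast
    show ?case
    proof (cases "x \<unlhd> z")
      case True
      then have "\<forall>y\<in>insert x F. x \<unlhd> y"
        using z packet_le_linear_order(1,3) by blast
      then show ?thesis by blast
    next
      case False
      then have "z \<unlhd> x" using packet_le_linear_order(4) by blast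
      then show ?thesis using z by auto
    qed
  qed
  then obtain x where x: "x \<in> P" "\<And>y. y \<in> P \<Longrightarrow> x \<unlhd> y" by blast
  then have "packet_min P = x" by (rule packet_min_eqI)
  then show "packet_min P \<in> P" "\<And>y. y \<in> P \<Longrightarrow> packet_min P \<unlhd> y"
    using x by auto
qed

text \<open>Earliest deadline first: the position of a packet is its rank in \<unlhd>. In any
  schedule \<open>g\<close> from \<open>t\<close> on, a packet and its predecessors occupy distinct
  steps before its deadline, since the predecessors have no later deadlines; so the rank is small
  enough.\<close>

lemma schedulable_initial:
  assumes "schedulable t X" "finite X" "\<And>x. x \<in> X \<Longrightarrow> release x \<le> t"
  shows "\<exists>f. inj_on f X \<and> f ` X = {t..<t + card X} \<and> (\<forall>x\<in>X. f x < deadline x) \<and>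
    (\<forall>x\<in>X. \<forall>y\<in>X. x \<unlhd> y \<longrightarrow> f x \<le> f y)"
proof -
  obtain g where g: "inj_on g X" "\<And>x. x \<in> X \<Longrightarrow> t \<le> g x" "\<And>x. x \<in> X \<Longrightarrow> g x < deadline x"
    using assms(1) unfolding schedulable_def matchable_def by blast
  define P where "P x = {y \<in> X. y \<unlhd> x \<and> y \<noteq> x}" for x
  define f where "f x = t + card (P x)" for x
  have finP: "finite (P x)" for x using assms(2) by (simp add: P_def)
  have mono: "f x < f y" if "x \<in> X" "y \<in> X" "x \<unlhd> y" "x \<noteq> y" for x y
  proof -
    have "P x \<subset> P y"
      using that packet_le_linear_order(2,3) unfolding P_def by blast
    then show ?thesis by (simp add: f_def finP psubset_card_mono)
  qed
  have inj: "inj_on f X"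
  proof (rule inj_onI, rule ccontr)
    fix x y assume "x \<in> X" "y \<in> X" "f x = f y" "x \<noteq> y"
    then show False
      using mono[of x y] mono[of y x] packet_le_linear_order(4)[of x y] by auto
  qed
  have "f x < t + card X" if "x \<in> X" for x
  proof -
    have "P x \<subset> X" using that by (auto simp: P_def)
    then show ?thesis by (simp add: f_def assms(2) psubset_card_mono)
  qed
  then have "f ` X \<subseteq> {t..<t + card X}" by (auto simp: f_def)
  then have im: "f ` X = {t..<t + card X}"
    using inj by (intro card_subset_eq) (auto simp: card_image)
  have dl: "f x < deadline x" if xX: "x \<in> X" for x
  proof -
    have "g ` insert x (P x) \<subseteq> {t..<deadline x}"
    proof
      fix s assume "s \<in> g ` insert x (P x)"
      then obtain y where y: "y \<in> X" "y \<unlhd> x" "s = g y"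
        using xX packet_le_linear_order(1)[of x] unfolding P_def by blast
      then have "deadline y \<le> deadline x" by (auto simp: packet_le_def)
      then show "s \<in> {t..<deadline x}" using y g(2,3)[of y] by auto
    qed
    moreover have "card (g ` insert x (P x)) = Suc (card (P x))"
    proof -
      have "inj_on g (insert x (P x))"
        using g(1) by (rule inj_on_subset) (auto simp: P_def that)
      then show ?thesis using finP by (simp add: card_image P_def)
    qed
    ultimately have "Suc (card (P x)) \<le> deadline x - t"
      by (metis card_mono finite_atLeastLessThan card_atLeastLessThan)
    then show ?thesis by (simp add: f_def)
  qed
  have "f x \<le> f y" if "x \<in> X" "y \<in> X" "x \<unlhd> y" for x y
    using mono that by (cases "x = y") (auto simp: less_imp_le)
  then show ?thesis using inj im dl by blast
qed

text \<open>\<open>optimal_le_schedule\<close> compares only \<unlhd>-schedules; this extends the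
  comparison to every schedulable set of released packets. Sending in \<unlhd>-order without gaps
  always sends the minimum of what is left.\<close>

lemma ex_le_schedule:
  assumes "schedulable t X" "finite X" "X \<subseteq> B" "\<And>x. x \<in> X \<Longrightarrow> release x \<le> t"
  shows "\<exists>S. feasible B S \<and> le_schedule_from t S \<and> ran S = X"
proof -
  obtain f where f: "inj_on f X" "f ` X = {t..<t + card X}" "\<forall>x\<in>X. f x < deadline x"
    "\<forall>x\<in>X. \<forall>y\<in>X. x \<unlhd> y \<longrightarrow> f x \<le> f y"
    using schedulable_initial[OF assms(1,2,4)] by blast
  define S where "S s = (if s \<in> f ` X then Some (inv_into X f s) else None)" for s
  have Siff: "S s = Some x \<longleftrightarrow> x \<in> X \<and> f x = s" for s x
    by (auto simp: S_def inv_into_f_f[OF f(1)] inj_on_eq_iff[OF f(1)])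
  have ran: "ran S = X"
    by (auto simp: ran_def Siff)
  have sent: "sent_before S s = {x \<in> X. f x < s}" for s
    by (auto simp: sent_before_def Siff)
  have ge: "t \<le> f x" if "x \<in> X" for x
    using f(2) that by auto
  have rel: "release x \<le> f x" if "x \<in> X" for x
    using ge assms(4) that le_trans by blast
  have "inj_on S (dom S)"
  proof (rule inj_onI)
    fix s u assume su: "s \<in> dom S" "S s = S u"
    then obtain x where "S s = Some x" by blast
    moreover from this have "S u = Some x" using su(2) by simp
    ultimately show "s = u" by (auto simp: Siff)
  qed
  then have "feasible B S"
    using assms(3) f(3) rel by (auto simp: feasible_def pending_def Siff sent)
  moreover have "le_schedule_from t S"
    unfolding le_schedule_from_def Let_def
  proof (intro conjI allI impI)
    show "dom S \<subseteq> {t..}"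
      using ge by (auto simp: Siff)
  next
    fix s assume s: "t \<le> s"
    let ?Q = "pending (ran S) (sent_before S s) s"
    have Q: "?Q = {x \<in> X. s < deadline x \<and> s \<le> f x}"
      using s assms(4) by (auto simp: pending_def ran sent intro: le_trans)
    show "S s = (if ?Q = {} then None else Some (packet_min ?Q))"
    proof (cases "S s")
      case None
      have "s \<notin> f ` X" using None by (auto simp: S_def split: if_splits)
      then have "t + card X \<le> s" using f(2) s by auto
      moreover have "f x < t + card X" if "x \<in> X" for x
        using that f(2) by auto
      ultimately have "?Q = {}"
        unfolding Q by fastforce
      then show ?thesis using None by simp
    next
      case (Some x)
      then have x: "x \<in> X" "f x = s" by (auto simp: Siff)
      then have xQ: "x \<in> ?Q" using f(3) by (auto simp: Q)
      have "packet_min ?Q = x"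
      proof (rule packet_min_eqI[OF xQ])
        fix y assume "y \<in> ?Q"
        then have y: "y \<in> X" "f x \<le> f y" by (auto simp: Q x)
        show "x \<unlhd> y"
        proof (rule ccontr)
          assume n: "\<not> x \<unlhd> y"
          then have "y \<unlhd> x" using packet_le_linear_order(4) by blast
          then have "f y = f x" using f(4) x(1) y by (blast intro: le_antisym)
          then show False using n f(1) x y packet_le_linear_order(1) by (metis inj_onD)
        qed
      qed
      then show ?thesis using xQ Some by auto
    qed
  qed
  ultimately show ?thesis using ran by blast
qed

lemma feasible_schedulable:
  assumes "feasible B S" "dom S \<subseteq> {t..}"
  shows "schedulable t (ran S)" "ran S \<subseteq> B"
proof -
  show "ran S \<subseteq> B" using assms(1) by (auto simp: feasible_def pending_def ran_def)
  define g where "g x = (SOME s. S s = Some x)" for x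
  have g: "S (g x) = Some x" if "x \<in> ran S" for x
    using that unfolding ran_def g_def by (metis (mono_tags, lifting) mem_Collect_eq someI_ex)
  show "schedulable t (ran S)"
  proof (rule schedulableI)
    show "inj_on g (ran S)" by (rule inj_onI) (metis g option.inject)
  next
    fix x assume "x \<in> ran S"
    then have "S (g x) = Some x" by (rule g)
    moreover from this have "g x \<in> dom S" by auto
    ultimately show "t \<le> g x \<and> release x \<le> g x \<and> g x < deadline x"
      using assms by (auto simp: feasible_def pending_def)
  qed
qed

text \<open>The link between the analysis and \<open>O\<^sub>t\<close>. The weight bound covers
  arbitrary schedulable subsets of the buffer because each can be rearranged into an
  \<unlhd>-schedule.\<close>

lemma optimal_le_scheduleD:
  assumes "optimal_le_schedule t B S" "finite B"
    and "\<And>x. x \<in> B \<Longrightarrow> release x \<le> t \<and> t < deadline x"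
  shows "schedulable t (ran S)" "ran S \<subseteq> B"
    and "\<And>X. X \<subseteq> B \<Longrightarrow> schedulable t X \<Longrightarrow> sum weight X \<le> sum weight (ran S)"
    and "S t = (if ran S = {} then None else Some (packet_min (ran S)))"
proof -
  have S: "feasible B S" "le_schedule_from t S" "dom S \<subseteq> {t..}"
    using assms(1) by (auto simp: optimal_le_schedule_def le_schedule_from_def)
  show 1: "schedulable t (ran S)" "ran S \<subseteq> B"
    using feasible_schedulable S by blast+
  show "sum weight X \<le> sum weight (ran S)" if "X \<subseteq> B" "schedulable t X" for X
  proof -
    have "\<exists>S'. feasible B S' \<and> le_schedule_from t S' \<and> ran S' = X"
      using ex_le_schedule that assms(2,3) finite_subset by (metis subsetD)
    then show ?thesis
      using assms(1) unfolding optimal_le_schedule_def schedule_weight_def by metis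
  qed
  have "sent_before S t = {}" using S(3) by (force simp: sent_before_def)
  then have "pending (ran S) (sent_before S t) t = ran S"
    using 1 assms(3) by (auto simp: pending_def)
  then show "S t = (if ran S = {} then None else Some (packet_min (ran S)))"
    using S(2) unfolding le_schedule_from_def Let_def by (metis order_refl)
qed

section \<open>The offline optimum from a given step on\<close>

text \<open>The \<open>V\<close> of the overview; packets still to arrive count too.\<close>

definition opt_from :: "nat \<Rightarrow> packet set \<Rightarrow> real" where
  "opt_from t Y = Max (sum weight ` {X. X \<subseteq> Y \<and> schedulable t X})"

lemma schedulable_empty [simp]: "schedulable t {}"
  by (rule schedulableI) auto

lemma opt_from_ge:
  assumes "finite Y" "X \<subseteq> Y" "schedulable t X"
  shows "sum weight X \<le> opt_from t Y"
  unfolding opt_from_def using assms by (intro Max_ge) auto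

lemma opt_from_attained:
  assumes "finite Y"
  obtains X where "X \<subseteq> Y" "schedulable t X" "sum weight X = opt_from t Y"
proof -
  have "opt_from t Y \<in> sum weight ` {X. X \<subseteq> Y \<and> schedulable t X}"
    unfolding opt_from_def using assms by (intro Max_in) (auto intro: exI[of _ "{}"])
  then show thesis using that by auto
qed

text \<open>Among the optima for \<open>Y\<close>, take one with the fewest buffer packets outside
  \<open>R\<close>, and exchange such a packet \<open>k\<close> with \<open>R\<close>. Adding
  \<open>k\<close> to \<open>R\<close> contradicts the maximality of \<open>R\<close>. Replacing
  \<open>m\<close> by \<open>k\<close> in \<open>R\<close> shows that \<open>m\<close> is at least
  as heavy, so replacing \<open>k\<close> by \<open>m\<close> in the optimum keeps it optimal and
  lowers the count.\<close>

lemma optimal_within_buffer: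
  assumes "finite Y" "B \<subseteq> Y" "R \<subseteq> B" "schedulable t R" "\<And>x. x \<in> Y \<Longrightarrow> 0 < weight x"
    and R: "\<And>X. X \<subseteq> B \<Longrightarrow> schedulable t X \<Longrightarrow> sum weight X \<le> sum weight R"
  obtains A where "A \<subseteq> Y" "schedulable t A" "sum weight A = opt_from t Y" "A \<inter> B \<subseteq> R"
proof -
  define Opt where "Opt A \<longleftrightarrow> A \<subseteq> Y \<and> schedulable t A \<and> sum weight A = opt_from t Y" for A
  have "\<exists>A. Opt A" using opt_from_attained[OF assms(1)] unfolding Opt_def by metis
  then obtain A where A: "Opt A"
    and least: "\<And>A'. Opt A' \<Longrightarrow> card (A \<inter> B - R) \<le> card (A' \<inter> B - R)"
    using ex_has_least_nat[of Opt _ "\<lambda>A. card (A \<inter> B - R)"] by blast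
  have AY: "A \<subseteq> Y" and sA: "schedulable t A" and wA: "sum weight A = opt_from t Y"
    using A by (auto simp: Opt_def)
  have fA: "finite A" and fR: "finite R" and fB: "finite B"
    using AY assms(1,2,3) by (meson finite_subset)+
  have "A \<inter> B \<subseteq> R"
  proof (rule ccontr)
    assume "\<not> A \<inter> B \<subseteq> R"
    then obtain k where k: "k \<in> A" "k \<in> B" "k \<notin> R" by blast
    from matchable_exchange[OF fA _ _ k(1,3)] sA assms(4)
    consider "schedulable t (insert k R)"
      | m where "m \<in> R - A" "schedulable t (insert m (A - {k}))" "schedulable t (insert k (R - {m}))"
      unfolding schedulable_def by blast
    then show False
    proof cases
      case 1
      then have "sum weight (insert k R) \<le> sum weight R"
        using k assms(3) by (intro R) auto
      moreover have "0 < weight k" using assms k AY by auto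
      ultimately show False using k fR by simp
    next
      case 2
      let ?A = "insert m (A - {k})"
      have "sum weight (insert k (R - {m})) \<le> sum weight R"
        using k assms(3) 2 by (intro R) auto
      then have "weight k \<le> weight m"
        using k fR 2 by (simp add: sum_diff1)
      moreover have "?A \<subseteq> Y" using 2 AY assms(2,3) by auto
      moreover have "sum weight ?A \<le> opt_from t Y"
        using calculation 2 assms(1) by (intro opt_from_ge) auto
      moreover have "sum weight ?A = sum weight A - weight k + weight m"
        using fA k 2 by (simp add: sum_diff1)
      ultimately have "Opt ?A"
        using 2 wA by (simp add: Opt_def)
      moreover have "card (?A \<inter> B - R) < card (A \<inter> B - R)"
      proof -
        have "?A \<inter> B - R = A \<inter> B - R - {k}" using 2(1) by auto
        then show ?thesis using k fA by (simp only:) (intro card_Diff1_less; simp)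
      qed
      ultimately show False using least[of ?A] by simp
    qed
  qed
  then show thesis using that AY sA wA by blast
qed

section \<open>Freeing step \<open>t\<close> by removing a packet\<close>

text \<open>If another packet holds step \<open>t\<close>, it moves to the step of \<open>e\<close>:
  it has been released by \<open>t\<close>, and its deadline is no earlier than that of
  \<open>e\<close>.\<close>

lemma schedulable_Suc_remove_first:
  assumes "schedulable t X" "e \<in> X" "release e \<le> t"
    and "\<And>x. x \<in> X \<Longrightarrow> release x \<le> t \<Longrightarrow> deadline e \<le> deadline x"
  shows "schedulable (Suc t) (X - {e})"
proof -
  obtain f where f: "inj_on f X" "\<And>x. x \<in> X \<Longrightarrow> t \<le> f x" "\<And>x. x \<in> X \<Longrightarrow> release x \<le> f x"
    "\<And>x. x \<in> X \<Longrightarrow> f x < deadline x"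
    using assms(1) unfolding schedulable_def matchable_def by blast
  define g where "g x = (if f x = t then f e else f x)" for x
  show ?thesis
  proof (rule schedulableI)
    show "inj_on g (X - {e})"
      using f(1) assms(2) unfolding inj_on_def g_def by (metis DiffE insertCI)
  next
    fix x assume x: "x \<in> X - {e}"
    show "Suc t \<le> g x \<and> release x \<le> g x \<and> g x < deadline x"
    proof (cases "f x = t")
      case True
      then have "f e \<noteq> t" using f(1) x assms(2) by (metis DiffE inj_onD insertCI)
      moreover have "release x \<le> t" using True f(3) x by auto
      moreover from this have "deadline e \<le> deadline x" using assms(4) x by auto
      ultimately show ?thesis
        using True f(2,4)[OF assms(2)] by (auto simp: g_def)
    next
      case False
      then show ?thesis using f(2,3,4)[of x] x by (auto simp: g_def)
    qed
  qed
qed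

lemma schedulable_Suc_remove_some:
  assumes "schedulable t X"
  shows "schedulable (Suc t) X \<or> (\<exists>j\<in>X. release j \<le> t \<and> schedulable (Suc t) (X - {j}))"
proof -
  obtain f where f: "inj_on f X" "\<And>x. x \<in> X \<Longrightarrow> t \<le> f x" "\<And>x. x \<in> X \<Longrightarrow> release x \<le> f x"
    "\<And>x. x \<in> X \<Longrightarrow> f x < deadline x"
    using assms unfolding schedulable_def matchable_def by blast
  have *: "schedulable (Suc t) Z" if "Z \<subseteq> X" "\<forall>x\<in>Z. f x \<noteq> t" for Z
  proof (rule schedulableI)
    show "inj_on f Z" using f(1) that(1) by (rule inj_on_subset)
    show "Suc t \<le> f x \<and> release x \<le> f x \<and> f x < deadline x" if "x \<in> Z" for x
      using f(2,3,4)[of x] that \<open>Z \<subseteq> X\<close> \<open>\<forall>x\<in>Z. f x \<noteq> t\<close>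
      by (metis Suc_leI le_neq_implies_less subsetD)
  qed
  show ?thesis
  proof (cases "\<exists>j\<in>X. f j = t")
    case True
    then obtain j where j: "j \<in> X" "f j = t" by blast
    have "schedulable (Suc t) (X - {j})"
      using f(1) j by (intro *) (auto dest: inj_onD)
    then show ?thesis using j f(3) by fastforce
  next
    case False
    then show ?thesis using * by blast
  qed
qed

text \<open>
  Agreeable deadlines let the packets \<open>F\<close> released later give way to the \<open>k\<close> released packets
  \<open>D\<close>, so that the latter occupy exactly the steps \<open>t, \<dots>, t + k - 1\<close>.  Since \<open>D\<close> survives a delay by
  one step, dropping any of its packets frees step \<open>t\<close>.
\<close>

lemma schedulable_Suc_remove_any:
  assumes "schedulable t (D \<union> F)" "schedulable (Suc t) D" "finite D" "finite F" "h \<in> D"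
    and D: "\<And>x. x \<in> D \<Longrightarrow> release x \<le> t"
    and F: "\<And>x. x \<in> F \<Longrightarrow> t < release x"
    and agree: "\<And>x y. x \<in> D \<Longrightarrow> y \<in> F \<Longrightarrow> deadline x \<le> deadline y"
  shows "schedulable (Suc t) (D - {h} \<union> F)"
proof -
  obtain f where f: "inj_on f (D \<union> F)" "\<And>x. x \<in> D \<union> F \<Longrightarrow> t \<le> f x"
    "\<And>x. x \<in> D \<union> F \<Longrightarrow> release x \<le> f x" "\<And>x. x \<in> D \<union> F \<Longrightarrow> f x < deadline x"
    using assms(1) unfolding schedulable_def matchable_def by blast
  have disj: "D \<inter> F = {}" using D F by fastforce
  define k where "k = card D"
  have k: "0 < k" using assms(3,5) by (auto simp: k_def card_gt_0_iff)
  have "schedulable (Suc t) (D - {h})"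
    using assms(2) by (rule schedulable_subset) auto
  then obtain a where a: "inj_on a (D - {h})" "a ` (D - {h}) = {Suc t..<Suc t + card (D - {h})}"
    "\<forall>x\<in>D - {h}. a x < deadline x"
    using schedulable_initial[of "Suc t" "D - {h}"] D assms(3) by (auto simp: le_SucI)
  have a2: "a ` (D - {h}) = {Suc t..<t + k}"
    using a(2) assms(3,5) k by (simp add: k_def card_Diff_singleton)
  define F1 where "F1 = {x \<in> F. f x < t + k}"
  define D1 where "D1 = {x \<in> D. f x < t + k}"
  define D2 where "D2 = {x \<in> D. t + k \<le> f x}"
  have fin: "finite F1" "finite D1" "finite D2" using assms by (auto simp: F1_def D1_def D2_def)
  \<comment> \<open>\<open>F1\<close> and \<open>D1\<close> share the \<open>k\<close> steps from
    \<open>t\<close> on, while \<open>D1\<close> and \<open>D2\<close> make up the \<open>k\<close>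
    packets of \<open>D\<close>. Hence \<open>D2\<close> vacates at least as many later steps as
    \<open>F1\<close> needs.\<close>
  have "card (F1 \<union> D1) \<le> card {t..<t + k}"
    using f(2) by (intro card_inj_on_le[of f])
      (auto simp: F1_def D1_def intro!: inj_on_subset[OF f(1)])
  moreover have "card (F1 \<union> D1) = card F1 + card D1"
    using fin disj by (intro card_Un_disjoint) (auto simp: F1_def D1_def)
  moreover have "card D = card D1 + card D2"
  proof -
    have "D = D1 \<union> D2" "D1 \<inter> D2 = {}" by (auto simp: D1_def D2_def)
    then show ?thesis using fin card_Un_disjoint by metis
  qed
  ultimately have "card F1 \<le> card D2" by (simp add: k_def)
  then obtain b where b: "b ` F1 \<subseteq> D2" "inj_on b F1"
    using card_le_inj[OF fin(1) fin(3)] by blast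
  \<comment> \<open>A packet of \<open>F1\<close> moves to the step that \<open>f\<close> gave to a
    packet of \<open>D2\<close>: this is later than its own step and, by \<open>agree\<close>, still
    in time.\<close>
  define g where "g x = (if x \<in> D then a x else if x \<in> F1 then f (b x) else f x)" for x
  have gD: "g x = a x" if "x \<in> D" for x using that by (simp add: g_def)
  have gF: "t + k \<le> g x \<and> release x \<le> g x \<and> g x < deadline x" if "x \<in> F" for x
  proof (cases "x \<in> F1")
    case True
    then have bx: "b x \<in> D" "t + k \<le> f (b x)" using b by (auto simp: D2_def)
    have "release x \<le> f x" "f x < t + k" using f(3) that True by (auto simp: F1_def)
    moreover have "f (b x) < deadline x"
      using f(4)[of "b x"] bx agree[of "b x" x] that by auto
    ultimately show ?thesis using bx True that disj by (auto simp: g_def)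
  next
    case False
    then show ?thesis using f(3,4)[of x] that disj by (auto simp: g_def F1_def)
  qed
  show ?thesis
  proof (rule schedulableI)
    have "inj_on g (D - {h})"
      using a(1) gD by (simp add: inj_on_def)
    moreover have "inj_on g F"
    proof (rule inj_onI)
      \<comment> \<open>Below, \<open>c z\<close> is the packet whose step under \<open>f\<close> is
        taken by \<open>z\<close>, so injectivity of \<open>g\<close> on \<open>F\<close> reduces to
        that of \<open>f\<close> and \<open>b\<close>.\<close>
      fix x y assume xy: "x \<in> F" "y \<in> F" "g x = g y"
      define c where "c z = (if z \<in> F1 then b z else z)" for z
      have c: "g z = f (c z)" "c z \<in> D \<union> F" if "z \<in> F" for z
        using that disj b by (auto simp: g_def c_def D2_def)
      then have "c x = c y" using f(1) xy by (metis inj_onD)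
      then show "x = y"
        using xy b disj unfolding c_def D2_def
        by (auto split: if_splits dest: inj_onD)
    qed
    moreover have "g x \<noteq> g y" if "x \<in> D - {h}" "y \<in> F" for x y
    proof -
      have "a x < t + k" using a2 that(1) by (metis atLeastLessThan_iff imageI)
      then show ?thesis using gF[OF that(2)] gD that(1) by auto
    qed
    ultimately show "inj_on g (D - {h} \<union> F)"
      unfolding inj_on_Un by blast
  next
    fix x assume "x \<in> D - {h} \<union> F"
    then consider "x \<in> D - {h}" | "x \<in> F" by blast
    then show "Suc t \<le> g x \<and> release x \<le> g x \<and> g x < deadline x"
    proof cases
      case 1
      then have "Suc t \<le> a x" using a2 by (metis atLeastLessThan_iff imageI)
      then show ?thesis using a(3) D[of x] 1 gD by auto
    next
      case 2
      then show ?thesis using gF[OF 2] k by auto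
    qed
  qed
qed


section \<open>The loss of the optimum in one step of RG\<close>

lemma opt_from_Suc_ge:
  assumes fA: "finite A" and A: "schedulable t A"
  obtains "opt_from (Suc t) A \<ge> sum weight A"
    | j where "j \<in> A" "release j \<le> t" "opt_from (Suc t) A \<ge> sum weight A - weight j"
  using schedulable_Suc_remove_some[OF A]
proof (elim disjE bexE conjE)
  assume "schedulable (Suc t) A"
  then show thesis using that(1) opt_from_ge[OF fA] by blast
next
  fix j assume j: "j \<in> A" "release j \<le> t" "schedulable (Suc t) (A - {j})"
  then have "sum weight (A - {j}) \<le> opt_from (Suc t) A"
    using fA by (intro opt_from_ge) auto
  then show thesis using that(2) j fA by (simp add: sum_diff1)
qed

lemma opt_from_mono:
  assumes "finite Y" "X \<subseteq> Y"
  shows "opt_from t X \<le> opt_from t Y"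
proof -
  have "finite X" using assms by (meson finite_subset)
  then obtain Z where "Z \<subseteq> X" "schedulable t Z" "sum weight Z = opt_from t X"
    by (rule opt_from_attained)
  then show ?thesis using opt_from_ge[OF assms(1), of Z t] assms(2) by simp
qed

lemma opt_from_step:
  fixes t :: nat and Y B R :: "packet set" and e h :: packet
  defines "p \<equiv> weight e / weight h"
  assumes Y: "finite Y" "agreeable_deadlines Y" "\<And>x. x \<in> Y \<Longrightarrow> 0 < weight x"
    and B: "B = {x \<in> Y. release x \<le> t \<and> t < deadline x}"
    and R: "R \<subseteq> B" "schedulable t R"
      "\<And>X. X \<subseteq> B \<Longrightarrow> schedulable t X \<Longrightarrow> sum weight X \<le> sum weight R"
    and e: "e \<in> R" "\<And>x. x \<in> R \<Longrightarrow> e \<unlhd> x"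
    and h: "h \<in> R" "\<And>x. x \<in> R \<Longrightarrow> weight x \<le> weight h"
  shows "opt_from t Y
    \<le> weight h + p * opt_from (Suc t) (Y - {e}) + (1 - p) * opt_from (Suc t) (Y - {h})"
proof -
  have BY: "B \<subseteq> Y" by (auto simp: B)
  obtain A where A: "A \<subseteq> Y" "schedulable t A" "sum weight A = opt_from t Y" "A \<inter> B \<subseteq> R"
    using optimal_within_buffer[OF Y(1) BY R(1,2) Y(3) R(3)] .
  have fA: "finite A" using A Y by (meson finite_subset)
  have early: "x \<in> B" if "x \<in> A" "release x \<le> t" for x
  proof -
    have "t < deadline x"
      using A(2) that(1) unfolding schedulable_def matchable_def by fastforce
    then show ?thesis using that A(1) by (auto simp: B)
  qed
  have wh: "0 < weight h" and we: "0 < weight e" using e h R BY Y(3) by auto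
  have p: "0 \<le> p" "p \<le> 1" "p * weight h = weight e"
    using wh we h(2)[OF e(1)] by (auto simp: p_def)
  have e_le: "deadline e \<le> deadline x" if "x \<in> R" for x
    using e(2)[OF that] by (auto simp: packet_le_def)
  have re: "release e \<le> t" using e R by (auto simp: B)
  let ?W = "opt_from t Y" and ?Ve = "opt_from (Suc t) (Y - {e})" and ?Vh = "opt_from (Suc t) (Y - {h})"
  show ?thesis
  proof (cases "e \<in> A")
    case True
    have s: "schedulable (Suc t) (A - {e})"
      using schedulable_Suc_remove_first[OF A(2) True re] early A(4) e_le by blast
    have "sum weight (A - {e}) \<le> ?Ve"
      using s Y(1) A(1) by (intro opt_from_ge) auto
    then have Ve: "?W - weight e \<le> ?Ve"
      using fA True A(3) by (simp add: sum_diff1)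
    \<comment> \<open>\<open>h\<close> may equal \<open>e\<close> or lie outside \<open>A\<close>;
      then less is lost, and the bound still holds because \<open>weight h\<close> is
      positive.\<close>
    have "sum weight (A - {e} - {h}) \<le> ?Vh"
      using s Y(1) A(1) by (intro opt_from_ge) (auto intro: schedulable_subset)
    then have Vh: "?W - weight e - weight h \<le> ?Vh"
      using fA True A(3) wh by (auto simp: sum_diff1 split: if_splits)
    \<comment> \<open>The mean loss is \<open>weight e + (1 - p) * weight h\<close>, which is
      \<open>weight h\<close> because \<open>p * weight h = weight e\<close>.\<close>
    have "?W = weight h + p * (?W - weight e) + (1 - p) * (?W - weight e - weight h)"
      using p(3) by (simp add: algebra_simps)
    also have "\<dots> \<le> weight h + p * ?Ve + (1 - p) * ?Vh"
      using Ve Vh p by (intro add_mono mult_left_mono) auto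
    finally show ?thesis .
  next
    case False
    \<comment> \<open>Giving up step \<open>t\<close> costs at most one packet, which is pending and
      so lies in \<open>R\<close>. This settles the removal of any packet outside \<open>A\<close>:
      of \<open>e\<close>, and of \<open>h\<close> if \<open>h \<notin> A\<close>.\<close>
    have VA: "?W - weight h \<le> opt_from (Suc t) A"
    proof (rule opt_from_Suc_ge[OF fA A(2)])
      assume "sum weight A \<le> opt_from (Suc t) A"
      then show ?thesis using A(3) wh by simp
    next
      fix j assume j: "j \<in> A" "release j \<le> t" "sum weight A - weight j \<le> opt_from (Suc t) A"
      then have "weight j \<le> weight h" using early A(4) h(2) by blast
      then show ?thesis using j A(3) by simp
    qed
    have Ve: "?W - weight h \<le> ?Ve"
      using VA opt_from_mono[of "Y - {e}" A "Suc t"] Y(1)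
        subset_Diff_insert[of A Y e "{}"] A(1) False by auto
    have Vh: "?W - weight h \<le> ?Vh"
    proof (cases "h \<in> A")
      case True
      let ?D = "A \<inter> B" and ?F = "A - B"
      have "schedulable (Suc t) (R - {e})"
        using schedulable_Suc_remove_first[OF R(2) e(1) re] e_le by blast
      then have sD: "schedulable (Suc t) ?D"
        by (rule schedulable_subset) (use A(4) False in auto)
      have F: "t < release x" if "x \<in> ?F" for x
        using early that by (metis DiffD1 DiffD2 not_le)
      have agree: "deadline x \<le> deadline y" if "x \<in> ?D" "y \<in> ?F" for x y
      proof -
        have "release x < release y" using that F[OF that(2)] by (auto simp: B)
        then show ?thesis
          using Y(2) that A(1) unfolding agreeable_deadlines_def by blast
      qed
      have "?D \<union> ?F = A" by auto
      then have "schedulable (Suc t) (?D - {h} \<union> ?F)"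
        using A(2) sD fA True h(1) R(1) F agree
        by (intro schedulable_Suc_remove_any) (auto simp: B)
      moreover have "?D - {h} \<union> ?F = A - {h}" using True h(1) R(1) by auto
      ultimately have "sum weight (A - {h}) \<le> ?Vh"
        using Y(1) A(1) by (intro opt_from_ge) auto
      then show ?thesis using fA True A(3) by (simp add: sum_diff1)
    next
      case False
      then show ?thesis
        using VA opt_from_mono[of "Y - {h}" A "Suc t"] Y(1)
          subset_Diff_insert[of A Y h "{}"] A(1) by auto
    qed
    have "?W = weight h + p * (?W - weight h) + (1 - p) * (?W - weight h)"
      by (simp add: algebra_simps)
    also have "\<dots> \<le> weight h + p * ?Ve + (1 - p) * ?Vh"
      using Ve Vh p by (intro add_mono mult_left_mono) auto
    finally show ?thesis .
  qed
qed

text \<open>The case of an empty \<open>O\<^sub>t\<close>. With \<open>R = {}\<close> there is an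
  optimum without pending packets, and only a pending packet could occupy step
  \<open>t\<close>.\<close>

lemma opt_from_idle_step:
  assumes Y: "finite Y" "\<And>x. x \<in> Y \<Longrightarrow> 0 < weight x"
    and B: "B = {x \<in> Y. release x \<le> t \<and> t < deadline x}"
    and R: "\<And>X. X \<subseteq> B \<Longrightarrow> schedulable t X \<Longrightarrow> sum weight X \<le> 0"
  shows "opt_from t Y \<le> opt_from (Suc t) Y"
proof -
  obtain A where A: "A \<subseteq> Y" "schedulable t A" "sum weight A = opt_from t Y" "A \<inter> B \<subseteq> {}"
    using optimal_within_buffer[of Y B "{}" t] Y R by (auto simp: B)
  obtain f where f: "inj_on f A" "\<And>x. x \<in> A \<Longrightarrow> t \<le> f x" "\<And>x. x \<in> A \<Longrightarrow> release x \<le> f x"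
    "\<And>x. x \<in> A \<Longrightarrow> f x < deadline x"
    using A(2) unfolding schedulable_def matchable_def by blast
  have "schedulable (Suc t) A"
  proof (rule schedulableI[OF f(1)])
    fix x assume x: "x \<in> A"
    then have "x \<in> Y" "x \<notin> B" using A by auto
    then have "f x \<noteq> t" using f(3,4)[OF x] by (auto simp: B)
    then show "Suc t \<le> f x \<and> release x \<le> f x \<and> f x < deadline x"
      using f(2-4)[OF x] by auto
  qed
  then show ?thesis using opt_from_ge[OF Y(1) A(1)] A(3) by metis
qed

section \<open>The potential as a submartingale\<close>

lemma heaviest:
  assumes "finite (ran S)" "ran S \<noteq> {}"
  shows "heaviest S \<in> ran S" "\<And>x. x \<in> ran S \<Longrightarrow> weight x \<le> weight (heaviest S)"
proof -
  let ?P = "{j \<in> ran S. \<forall>i\<in>ran S. weight i \<le> weight j}"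
  have "Max (weight ` ran S) \<in> weight ` ran S" using assms by simp
  then obtain j where "j \<in> ran S" "weight j = Max (weight ` ran S)" by auto
  then have "j \<in> ?P" using assms by simp
  then have "heaviest S \<in> ?P"
    unfolding heaviest_def using assms by (intro packet_min(1)) auto
  then show "heaviest S \<in> ran S" "\<And>x. x \<in> ran S \<Longrightarrow> weight x \<le> weight (heaviest S)"
    by auto
qed

lemma gain_snoc: "gain (xs @ [x]) = gain xs + (case x of None \<Rightarrow> 0 | Some j \<Rightarrow> weight j)"
  by (simp add: gain_def)

lemma transmitted_snoc:
  "transmitted (xs @ [None]) = transmitted xs"
  "transmitted (xs @ [Some j]) = insert j (transmitted xs)"
  by (auto simp: transmitted_def)

text \<open>It starts at \<open>opt_from 1 I\<close>; at the horizon only the gain, scaled by the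
  ratio \<open>4 / 3\<close>, is left.\<close>

definition potential :: "packet set \<Rightarrow> history \<Rightarrow> real" where
  "potential I xs = 4 / 3 * gain xs + opt_from (Suc (length xs)) (I - transmitted xs)"

lemma potential_le_rg_step:
  assumes "input_sequence I" "agreeable_deadlines I" "valid_choice_rule C"
  shows "potential I xs \<le> measure_pmf.expectation (rg_step C I xs) (\<lambda>x. potential I (xs @ [x]))"
proof -
  define t where "t = Suc (length xs)"
  define S where "S = C (arrived I t) xs"
  define Y where "Y = I - transmitted xs"
  define B where "B = {x \<in> Y. release x \<le> t \<and> t < deadline x}"
  have Y: "finite Y" "agreeable_deadlines Y" "\<And>x. x \<in> Y \<Longrightarrow> 0 < weight x"
    using assms(1,2) by (auto simp: Y_def input_sequence_def agreeable_deadlines_def)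
  have fB: "finite B" using Y(1) by (simp add: B_def)
  have "input_sequence (arrived I t)"
    using assms(1) by (auto simp: input_sequence_def arrived_def intro: inj_on_subset)
  moreover have "pending (arrived I t) (transmitted xs) t = B"
    by (auto simp: pending_def arrived_def B_def Y_def)
  ultimately have opt: "optimal_le_schedule t B S"
    using assms(3) unfolding valid_choice_rule_def Let_def t_def S_def
    by (metis (no_types, lifting) arrived_def mem_Collect_eq)
  have "release x \<le> t \<and> t < deadline x" if "x \<in> B" for x
    using that by (simp add: B_def)
  note S = optimal_le_scheduleD[OF opt fB this]
  have pot: "potential I xs = 4 / 3 * gain xs + opt_from t Y"
    by (simp add: potential_def t_def Y_def)
  have pot_Some: "potential I (xs @ [Some j]) =
      4 / 3 * gain xs + 4 / 3 * weight j + opt_from (Suc t) (Y - {j})" for j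
    by (simp add: potential_def gain_snoc transmitted_snoc t_def Y_def
        Diff_insert[of I j "transmitted xs"])
  show ?thesis
  proof (cases "ran S = {}")
    case True
    \<comment> \<open>An empty \<open>O\<^sub>t\<close> makes RG idle, and its maximality means that
      no schedulable subset of the buffer has positive weight.\<close>
    then have "rg_step C I xs = return_pmf None"
      using S(4) by (simp add: rg_step_def Let_def t_def S_def)
    moreover have "opt_from t Y \<le> opt_from (Suc t) Y"
      using opt_from_idle_step[OF Y(1,3) B_def] S(3) True by simp
    ultimately show ?thesis
      unfolding pot by (simp add: potential_def gain_snoc transmitted_snoc t_def Y_def)
  next
    case False
    define e where "e = packet_min (ran S)"
    define h where "h = heaviest S"
    define p where "p = weight e / weight h"
    have fin: "finite (ran S)" using S(2) fB by (rule finite_subset)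
    have e: "e \<in> ran S" "\<And>x. x \<in> ran S \<Longrightarrow> e \<unlhd> x"
      unfolding e_def using packet_min[OF fin False] by auto
    have h: "h \<in> ran S" "\<And>x. x \<in> ran S \<Longrightarrow> weight x \<le> weight h"
      unfolding h_def using heaviest[OF fin False] by auto
    have pos: "0 < weight e" "0 < weight h"
      using e h S(2) Y(3) by (auto simp: B_def)
    then have p: "0 \<le> p" "p \<le> 1" "weight e = p * weight h"
      using h(2)[OF e(1)] by (auto simp: p_def)
    have "S t = Some e" using S(4) False by (simp add: e_def)
    then have step: "rg_step C I xs = map_pmf (\<lambda>b. Some (if b then e else h)) (bernoulli_pmf p)"
      unfolding rg_step_def Let_def t_def[symmetric] S_def[symmetric] h_def[symmetric]
      by (simp add: p_def)
    \<comment> \<open>This square comes from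
      \<open>4 * (p\<^sup>2 - p + 1) = (2 * p - 1)\<^sup>2 + 3\<close>; the worst case is
      \<open>p = 1 / 2\<close>.\<close>
    have "0 \<le> weight h * (2 * p - 1)\<^sup>2" using pos by simp
    then have "weight h \<le> 4 / 3 * (p * weight e + (1 - p) * weight h)"
      by (simp add: p(3) power2_eq_square algebra_simps)
    moreover have "opt_from t Y \<le>
        weight h + p * opt_from (Suc t) (Y - {e}) + (1 - p) * opt_from (Suc t) (Y - {h})"
      unfolding p_def using opt_from_step[OF Y B_def S(2,1,3) e h] .
    ultimately have "potential I xs \<le>
        p * potential I (xs @ [Some e]) + (1 - p) * potential I (xs @ [Some h])"
      unfolding pot pot_Some by (simp add: field_simps)
    then show ?thesis using p by (simp add: step mult.commute)
  qed
qed

lemma finite_set_pmf_rg_step: "finite (set_pmf (rg_step C I xs))"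
  by (auto simp: rg_step_def Let_def split: option.split)

lemma finite_set_pmf_rg_run: "finite (set_pmf (rg_run C I n))"
  by (induction n) (auto simp: finite_set_pmf_rg_step)

lemma length_rg_run: "xs \<in> set_pmf (rg_run C I n) \<Longrightarrow> length xs = n"
  by (induction n arbitrary: xs) auto

text \<open>The last step is averaged first, given the history before it; the finite sum in the
  proof is the law of total expectation for \<open>bind_pmf\<close>.\<close>

lemma potential_le_rg_run:
  assumes "input_sequence I" "agreeable_deadlines I" "valid_choice_rule C"
  shows "potential I [] \<le> measure_pmf.expectation (rg_run C I n) (potential I)"
proof (induction n)
  case (Suc n)
  let ?M = "rg_run C I n"
  let ?E = "\<lambda>xs. measure_pmf.expectation (rg_step C I xs) (\<lambda>x. potential I (xs @ [x]))"
  have "measure_pmf.expectation ?M (potential I) \<le> measure_pmf.expectation ?M ?E"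
    using potential_le_rg_step[OF assms]
    by (intro integral_mono integrable_measure_pmf_finite finite_set_pmf_rg_run)
  also have "\<dots> = (\<Sum>xs\<in>set_pmf ?M. pmf ?M xs *\<^sub>R ?E xs)"
    by (rule integral_measure_pmf) (auto simp: finite_set_pmf_rg_run)
  also have "\<dots> = measure_pmf.expectation (rg_run C I (Suc n)) (potential I)"
    by (simp, subst pmf_expectation_bind[OF finite_set_pmf_rg_run[of C I n]])
      (auto simp: finite_set_pmf_rg_step)
  finally show ?case using Suc.IH by simp
qed simp

section \<open>Boundary values and the competitive ratio\<close>

lemma opt_from_after_horizon:
  assumes "finite I" "Y \<subseteq> I"
  shows "opt_from (Suc (horizon I)) Y = 0"
proof -
  obtain X where X: "X \<subseteq> Y" "schedulable (Suc (horizon I)) X"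
    "sum weight X = opt_from (Suc (horizon I)) Y"
    using opt_from_attained assms finite_subset by metis
  have "x \<notin> X" for x
  proof
    assume x: "x \<in> X"
    then have "deadline x \<le> horizon I"
      unfolding horizon_def using assms X(1) by (intro Max_ge) auto
    then show False
      using X(2) x unfolding schedulable_def matchable_def by fastforce
  qed
  then have "X = {}" by blast
  then show ?thesis using X(3) by simp
qed

lemma opt_gain_le_opt_from:
  assumes "input_sequence I"
  shows "opt_gain I \<le> opt_from 1 I"
proof -
  have fin: "finite I" using assms by (simp add: input_sequence_def)
  let ?G = "schedule_weight ` {S. feasible I S}"
  have "\<exists>x\<in>Pow I. schedule_weight S = sum weight x" if "feasible I S" for S
    using that feasible_schedulable(2)[of I S 0] by (auto simp: schedule_weight_def)
  then have "?G \<subseteq> sum weight ` Pow I" by blast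
  then have "finite ?G" using fin by (meson finite_Pow_iff finite_imageI finite_subset)
  moreover have "feasible I Map.empty" by (simp add: feasible_def)
  then have "?G \<noteq> {}" by blast
  ultimately have "Max ?G \<in> ?G" by (rule Max_in)
  then obtain S where S: "feasible I S" "schedule_weight S = opt_gain I"
    unfolding opt_gain_def by auto
  \<comment> \<open>Schedules are defined on all of \<open>nat\<close>; step \<open>0\<close> stays
    idle because arrivals are at least \<open>1\<close>.\<close>
  have "1 \<le> s" if "S s = Some j" for s j
  proof -
    have "j \<in> I" "release j \<le> s" using S(1) that by (auto simp: feasible_def pending_def)
    moreover have "1 \<le> arrival j" using assms \<open>j \<in> I\<close> by (auto simp: input_sequence_def)
    ultimately show ?thesis by (simp add: release_def) linarith
  qed
  then have "dom S \<subseteq> {1..}" by auto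
  then have "schedulable 1 (ran S)" "ran S \<subseteq> I"
    using feasible_schedulable[OF S(1)] by blast+
  then show ?thesis
    using opt_from_ge[OF fin] S(2) unfolding schedule_weight_def by metis
qed

theorem theorem3p2:
  fixes I :: "packet set" and C :: choice_rule
  assumes "input_sequence I"
    and "agreeable_deadlines I"
    and "valid_choice_rule C"
  shows "rg_expected_gain C I \<ge> 3 / 4 * opt_gain I"
proof -
  have fin: "finite I" using assms(1) by (simp add: input_sequence_def)
  let ?M = "rg_run C I (horizon I)"
  have "opt_gain I \<le> potential I []"
    using opt_gain_le_opt_from[OF assms(1)] by (simp add: potential_def gain_def transmitted_def)
  also have "\<dots> \<le> measure_pmf.expectation ?M (potential I)"
    by (rule potential_le_rg_run[OF assms])
  \<comment> \<open>All histories in the support have length \<open>horizon I\<close>, where the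
    second summand of the potential vanishes.\<close>
  also have "\<dots> = measure_pmf.expectation ?M (\<lambda>xs. 4 / 3 * gain xs)"
    by (intro integral_cong_AE AE_pmfI)
      (auto simp: potential_def length_rg_run opt_from_after_horizon[OF fin])
  also have "\<dots> = 4 / 3 * rg_expected_gain C I"
    by (simp add: rg_expected_gain_def)
  finally show ?thesis by simp
qed

end
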